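(* Let $k$ be a positive integer. Let $D$ be a directed graph on $n$ vertices with all in-degrees and out-degrees at least $8k$, and suppose that for every pair of disjoint sets $A,B\subseteq V(D)$ with $|A|=|B|\ge k$, there is an arc from $A$ to $B$ (that is, an arc $ab$ with $a\in A$, $b\in B$). Then $D$ is pancyclic.
   Context: Digraphs are finite, have no loops and no repeated arcs, but are allowed to contain 2-cycles (both $uv$ and $vu$ may be arcs). An $n$-vertex digraph is pancyclic if it contains (simple, directed) cycles of all lengths ranging from $3$ to $n$. *)

theory Defs
  imports Graph_Theory.Graph_Theory
begin

text \<open>
  A cycle is a list of arcs, so its length is the number of its arcs.  In a digraph with fewer
  than three vertices the condition is vacuous.
\<close>

definition pancyclic :: "('a, 'b) pre_digraph \<Rightarrow> bool" where
  "pancyclic G \<longleftrightarrow> (\<forall>l\<in>{3..card (verts G)}. \<exists>p. pre_digraph.cycle G p \<and> length p = l)"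

end

theory Submission
  imports Defs
begin

text \<open>
  A vertex \<open>v\<close> with at least \<open>4k\<close> in- and out-neighbours on a cycle can be absorbed into it: with
  \<open>u \<rightarrow> v \<rightarrow> y\<^sup>+\<close>, where \<open>u\<close> and \<open>y\<close> range over \<open>k\<close> vertices in separate segments, all but \<open>2k - 2\<close>
  of the vertices \<open>x\<close> have \<open>x \<rightarrow> u\<^sup>+\<close> and \<open>y \<rightarrow> x\<^sup>+\<close> for some \<open>u\<close> and \<open>y\<close>, and if \<open>x, u, y\<close> lie in this
  cyclic order, the rerouted arcs form a single cycle again.

  For disjoint \<open>k\<close>-sets \<open>A\<close> and \<open>B\<close> of out- and in-neighbours of a vertex \<open>v\<close>, the digraph without
  \<open>A\<close>, \<open>B\<close> and \<open>v\<close> has a Hamiltonian path: depth-first search gives a path missing at most \<open>2k - 2\<close>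
  vertices, which are then absorbed.  A window of this path with any prescribed number of vertices
  up to \<open>n - 4k + 1\<close> can be closed through \<open>B\<close>, \<open>v\<close> and \<open>A\<close>, since there are enough such windows to
  find one that starts at an out-neighbour of \<open>A\<close> and ends at an in-neighbour of \<open>B\<close>.  From length
  \<open>n - 4k + 4\<close> on, absorbing vertices one at a time gives the longer cycles.
\<close>

section \<open>Arcs between large sets; cycles as vertex lists\<close>

text \<open>A bare relation \<open>E\<close> allows passing to the converse and adding an arc. The
  sizes of \<open>A\<close> and \<open>B\<close> may differ; subsets of size \<open>k\<close> reduce
  this to equal sizes.\<close>

definition joined :: "nat \<Rightarrow> ('a \<Rightarrow> 'a \<Rightarrow> bool) \<Rightarrow> 'a set \<Rightarrow> bool" where
  "joined k E V \<longleftrightarrow> (\<forall>A B. A \<subseteq> V \<longrightarrow> B \<subseteq> V \<longrightarrow> A \<inter> B = {} \<longrightarrow> k \<le> card A \<longrightarrow> k \<le> card B \<longrightarrow>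
     (\<exists>a\<in>A. \<exists>b\<in>B. E a b))"

definition cyclic :: "('a \<Rightarrow> 'a \<Rightarrow> bool) \<Rightarrow> 'a list \<Rightarrow> bool" where
  "cyclic E c \<longleftrightarrow> c \<noteq> [] \<and> distinct c \<and> successively E c \<and> E (last c) (hd c)"

lemma joinedD:
  assumes "joined k E V" "A \<subseteq> V" "B \<subseteq> V" "A \<inter> B = {}" "k \<le> card A" "k \<le> card B"
  obtains a b where "a \<in> A" "b \<in> B" "E a b"
  using assms unfolding joined_def by meson

lemma joined_converse: "joined k E V \<Longrightarrow> joined k (\<lambda>x y. E y x) V"
  unfolding joined_def by (metis Int_commute)

lemma joined_mono: "joined k E V \<Longrightarrow> W \<subseteq> V \<Longrightarrow> (\<And>x y. E x y \<Longrightarrow> F x y) \<Longrightarrow> joined k F W"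
  unfolding joined_def by (meson subset_trans)

text \<open>The vertices \<open>f i\<close> over the exceptional indices form a set disjoint from
  \<open>A\<close> that receives no arc from \<open>A\<close>. Counting indices instead of vertices
  lets one index be tested through two maps.\<close>

lemma card_not_joined_less:
  assumes "joined k E V" "A \<subseteq> V" "k \<le> card A"
    and "inj_on f X" "f ` X \<subseteq> V - A"
  shows "card {i \<in> X. \<forall>a\<in>A. \<not> E a (f i)} < k"
proof (rule ccontr)
  let ?Z = "{i \<in> X. \<forall>a\<in>A. \<not> E a (f i)}"
  assume "\<not> card ?Z < k"
  moreover have "card (f ` ?Z) = card ?Z"
    by (rule card_image, rule inj_on_subset[OF assms(4)]) auto
  ultimately have "k \<le> card (f ` ?Z)" by simp
  then obtain a b where "a \<in> A" "b \<in> f ` ?Z" "E a b"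
    using joinedD[OF assms(1,2) _ _ assms(3), of "f ` ?Z"] assms(5) by blast
  then show False by auto
qed

text \<open>Each of the two requirements fails for at most \<open>k - 1\<close> indices, so among
  \<open>2 * k - 1\<close> indices some index meets both.\<close>

lemma joined_pick:
  assumes "joined k E V" "0 < k" "finite X" "2 * k - 1 \<le> card X"
    and "A \<subseteq> V" "k \<le> card A" "inj_on f X" "f ` X \<subseteq> V - A"
    and "B \<subseteq> V" "k \<le> card B" "inj_on g X" "g ` X \<subseteq> V - B"
  obtains i a b where "i \<in> X" "a \<in> A" "b \<in> B" "E a (f i)" "E (g i) b"
proof -
  let ?F = "{i \<in> X. \<forall>a\<in>A. \<not> E a (f i)}" and ?G = "{i \<in> X. \<forall>b\<in>B. \<not> E (g i) b}"
  have "card ?F < k" "card ?G < k"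
    using card_not_joined_less[OF assms(1,5-8)]
      card_not_joined_less[OF joined_converse[OF assms(1)] assms(9-12)] by auto
  then have "card (?F \<union> ?G) < card X"
    using card_Un_le[of ?F ?G] assms(2,4) by linarith
  then have "\<not> X \<subseteq> ?F \<union> ?G"
    using card_mono[of "?F \<union> ?G" X] assms(3) by auto
  then show thesis using that by blast
qed

lemma cyclic_rotate: "cyclic E (xs @ ys) \<Longrightarrow> cyclic E (ys @ xs)"
  unfolding cyclic_def by (cases "xs = []"; cases "ys = []") (auto simp: successively_append_iff)

lemma cyclic_rev: "cyclic E c \<Longrightarrow> cyclic (\<lambda>x y. E y x) (rev c)"
  unfolding cyclic_def by (auto simp: hd_rev last_rev)

section \<open>Absorbing a vertex into a cycle\<close>

text \<open>The removed arcs are \<open>xx\<^sup>+\<close>, \<open>uu\<^sup>+\<close> and \<open>yy\<^sup>+\<close>, where \<open>x\<close>, \<open>u\<close>, \<open>y\<close> sit at positions \<open>i\<close>, \<open>l\<close>, \<open>j\<close>.\<close>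
lemma cyclic_reroute:
  assumes "cyclic E c" "v \<notin> set c" "i < l" "l < j" "Suc j < length c"
    and "E (c ! i) (c ! Suc l)" "E (c ! j) (c ! Suc i)" "E (c ! l) v" "E v (c ! Suc j)"
  shows "\<exists>c'. cyclic E c' \<and> set c' = insert v (set c)"
proof -
  define a where "a = take (Suc i) c"
  define b where "b = take (l - i) (drop (Suc i) c)"
  define d where "d = take (j - l) (drop (Suc l) c)"
  define e where "e = drop (Suc j) c"
  have "drop (Suc l) c = d @ e"
    unfolding d_def e_def using assms(4) append_take_drop_id[of "j - l" "drop (Suc l) c"] by simp
  moreover have "drop (Suc i) c = b @ drop (Suc l) c"
    unfolding b_def using assms(3) append_take_drop_id[of "l - i" "drop (Suc i) c"] by simp
  ultimately have c: "c = a @ b @ d @ e"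
    unfolding a_def by (metis append_take_drop_id)
  have ne: "a \<noteq> []" "b \<noteq> []" "d \<noteq> []" "e \<noteq> []"
    unfolding a_def b_def d_def e_def using assms(3-5) by auto
  have ends: "last a = c ! i" "hd b = c ! Suc i" "last b = c ! l" "hd d = c ! Suc l"
      "last d = c ! j" "hd e = c ! Suc j"
    using assms(3-5) ne
    by (auto simp: a_def b_def d_def e_def last_conv_nth hd_conv_nth min_def)
  have "E (last a) (hd d)" "E (last d) (hd b)" "E (last b) v" "E v (hd e)"
    using assms(6-9) ends by simp_all
  \<comment> \<open>The four new arcs link the segments, except that \<open>e\<close> runs into
    \<open>a\<close> through the closing arc of \<open>c\<close>.\<close>
  then have "cyclic E (v # e @ a @ d @ b)"
    using assms(1,2) ne unfolding c cyclic_def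
    by (auto simp: successively_append_iff successively_Cons)
  moreover have "set (v # e @ a @ d @ b) = insert v (set c)" using c by auto
  ultimately show ?thesis by blast
qed

text \<open>The cyclic order needed for rerouting is forced by location: \<open>x\<close> lies in
  \<open>p1\<close>, \<open>u\<close> in \<open>p2\<close>, and the successor of \<open>y\<close> in
  \<open>tl q\<close>, hence \<open>y\<close> itself in \<open>q\<close>.\<close>

lemma cyclic_absorb_ordered:
  assumes "joined k E V" "0 < k" "cyclic E (p1 @ p2 @ q)" "set (p1 @ p2 @ q) \<subseteq> V"
    and "v \<notin> set (p1 @ p2 @ q)" "2 * k - 1 \<le> length p1"
    and "k \<le> card {u \<in> set p2. E u v}" "k \<le> card {w \<in> set (tl q). E v w}"
  shows "\<exists>c. cyclic E c \<and> set c = insert v (set (p1 @ p2 @ q))"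
proof -
  define c where "c = p1 @ p2 @ q"
  define m where "m = length p1 + length p2"
  \<comment> \<open>\<open>A\<close> holds the candidates for \<open>y\<close>, \<open>B\<close> the
    successors of the candidates for \<open>u\<close>. Wanted is a position \<open>i\<close> in
    \<open>p1\<close> with an arc from \<open>A\<close> to \<open>c ! Suc i\<close> and one from
    \<open>c ! i\<close> to \<open>B\<close>.\<close>
  define A where "A = (!) c ` {j. m \<le> j \<and> Suc j < length c \<and> E v (c ! Suc j)}"
  define B where "B = (\<lambda>i. c ! Suc i) ` {i. length p1 \<le> i \<and> i < m \<and> E (c ! i) v}"
  have dist: "distinct c" and sub: "set c \<subseteq> V"
    using assms(3,4) by (auto simp: cyclic_def c_def)
  have "tl q \<noteq> []" using assms(2,8) by (cases "tl q") auto
  then have "length (tl q) > 0" by blast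
  then have len: "Suc m < length c" by (simp add: m_def c_def)
  have inj: "inj_on (\<lambda>i. c ! Suc i) {i. Suc i < length c}"
    using dist by (auto simp: inj_on_def nth_eq_iff_index_eq)
  have inj': "inj_on ((!) c) {i. i < length c}"
    using dist by (auto simp: inj_on_def nth_eq_iff_index_eq)
  have "{w \<in> set (tl q). E v w} \<subseteq> (\<lambda>j. c ! Suc j) ` {j. m \<le> j \<and> Suc j < length c \<and> E v (c ! Suc j)}"
  proof
    fix w assume "w \<in> {w \<in> set (tl q). E v w}"
    then obtain r where r: "r < length (tl q)" "w = tl q ! r" "E v w"
      by (auto simp: in_set_conv_nth)
    then have "c ! Suc (m + r) = w" "Suc (m + r) < length c"
      by (auto simp: c_def m_def nth_append nth_tl)
    then show "w \<in> (\<lambda>j. c ! Suc j) ` {j. m \<le> j \<and> Suc j < length c \<and> E v (c ! Suc j)}"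
      using r by (intro image_eqI[of _ _ "m + r"]) auto
  qed
  then have "k \<le> card ((\<lambda>j. c ! Suc j) ` {j. m \<le> j \<and> Suc j < length c \<and> E v (c ! Suc j)})"
    by (rule order.trans[OF assms(8) card_mono[rotated]])
      (rule finite_imageI, rule finite_subset[of _ "{..<length c}"], auto)
  also have "\<dots> = card A" unfolding A_def
    by (subst card_image, rule inj_on_subset[OF inj], force,
        subst card_image, rule inj_on_subset[OF inj'], auto)
  finally have kA: "k \<le> card A" .
  have "{u \<in> set p2. E u v} \<subseteq> (!) c ` {i. length p1 \<le> i \<and> i < m \<and> E (c ! i) v}"
  proof
    fix u assume "u \<in> {u \<in> set p2. E u v}"
    then obtain r where r: "r < length p2" "u = p2 ! r" "E u v"
      by (auto simp: in_set_conv_nth)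
    then have "c ! (length p1 + r) = u"
      by (auto simp: c_def nth_append)
    then show "u \<in> (!) c ` {i. length p1 \<le> i \<and> i < m \<and> E (c ! i) v}"
      using r by (intro image_eqI[of _ _ "length p1 + r"]) (auto simp: m_def)
  qed
  then have "k \<le> card ((!) c ` {i. length p1 \<le> i \<and> i < m \<and> E (c ! i) v})"
    by (rule order.trans[OF assms(7) card_mono[rotated]]) simp
  also have "\<dots> = card B" unfolding B_def using len
    by (subst card_image, intro inj_on_subset[OF inj'], force,
        subst card_image, intro inj_on_subset[OF inj], auto)
  finally have kB: "k \<le> card B" .
  obtain i a b where i: "i \<in> {..<length p1}" "a \<in> A" "b \<in> B" "E a (c ! Suc i)" "E (c ! i) b"
  proof (rule joined_pick[OF assms(1,2), of "{..<length p1}" A "\<lambda>i. c ! Suc i" B "(!) c"])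
    show "A \<subseteq> V" "B \<subseteq> V" using sub len by (auto simp: A_def B_def)
    show "inj_on (\<lambda>i. c ! Suc i) {..<length p1}" "inj_on ((!) c) {..<length p1}"
      using len by (auto intro!: inj_on_subset[OF inj] inj_on_subset[OF inj'] simp: m_def)
    \<comment> \<open>As \<open>p2\<close> is nonempty, even the successor of the last vertex of
      \<open>p1\<close> comes before position \<open>m\<close>, hence lies outside
      \<open>A\<close>.\<close>
    have "length p1 < m" using assms(2,7) by (cases p2) (auto simp: m_def)
    then show "(\<lambda>i. c ! Suc i) ` {..<length p1} \<subseteq> V - A"
      using sub len dist by (auto simp: A_def nth_eq_iff_index_eq)
    show "(!) c ` {..<length p1} \<subseteq> V - B"
      using sub len dist by (auto simp: B_def m_def nth_eq_iff_index_eq)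
  qed (use kA kB assms(6) in auto)
  then obtain j l where "a = c ! j" "m \<le> j" "Suc j < length c" "E v (c ! Suc j)"
    "b = c ! Suc l" "length p1 \<le> l" "l < m" "E (c ! l) v"
    by (auto simp: A_def B_def)
  then show ?thesis
    using cyclic_reroute[of E c v i l j] i assms(3,5) by (auto simp: c_def)
qed

text \<open>Appending one entry raises the count by at most one, so the prefixes skip no value up to
  the total.\<close>

lemma prefix_card_split:
  assumes "r \<le> card {x \<in> set c. P x}"
  obtains p q where "c = p @ q" "card {x \<in> set p. P x} = r"
  using assms
proof (induction c arbitrary: thesis rule: rev_induct)
  case Nil
  then show ?case by simp
next
  case (snoc x c)
  show ?case
  proof (cases "r \<le> card {x \<in> set c. P x}")
    case True
    then show ?thesis using snoc.IH snoc.prems(1) by (metis append.assoc)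
  next
    case False
    have "{y \<in> set (c @ [x]). P y} \<subseteq> insert x {x \<in> set c. P x}" by auto
    then have "card {y \<in> set (c @ [x]). P y} \<le> card (insert x {x \<in> set c. P x})"
      by (intro card_mono) auto
    also have "\<dots> \<le> Suc (card {x \<in> set c. P x})" by (simp add: card_insert_if)
    finally show ?thesis using False snoc.prems(2) by (intro snoc.prems(1)[of "c @ [x]" "[]"]) auto
  qed
qed

lemma card_Collect_append_le:
  "card {x \<in> set (xs @ ys). P x} \<le> card {x \<in> set xs. P x} + card {x \<in> set ys. P x}"
proof -
  have "{x \<in> set (xs @ ys). P x} = {x \<in> set xs. P x} \<union> {x \<in> set ys. P x}" by auto
  then show ?thesis by (metis card_Un_le)
qed

text \<open>A prefix of \<open>p\<close> with exactly \<open>2 * k - 1\<close> in-neighbours of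
  \<open>v\<close> is long enough to supply \<open>x\<close> and leaves at least \<open>k\<close>
  in-neighbours as candidates for \<open>u\<close>.\<close>

lemma cyclic_absorb_prefix:
  assumes "joined k E V" "0 < k" "cyclic E (p @ q)" "set (p @ q) \<subseteq> V" "v \<notin> set (p @ q)"
    and "3 * k - 1 \<le> card {u \<in> set p. E u v}" "k \<le> card {w \<in> set (tl q). E v w}"
  shows "\<exists>c. cyclic E c \<and> set c = insert v (set (p @ q))"
proof -
  have "2 * k - 1 \<le> card {u \<in> set p. E u v}" using assms(6) by simp
  then obtain p1 p2 where p: "p = p1 @ p2" "card {u \<in> set p1. E u v} = 2 * k - 1"
    by (rule prefix_card_split)
  have "k \<le> card {u \<in> set p2. E u v}"
    using card_Collect_append_le[of p1 p2 "\<lambda>u. E u v"] p assms(6) by simp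
  moreover have "card {u \<in> set p1. E u v} \<le> card (set p1)" by (rule card_mono) auto
  then have "2 * k - 1 \<le> length p1" using p(2) card_length[of p1] by linarith
  ultimately show ?thesis
    using cyclic_absorb_ordered[OF assms(1,2), of p1 p2 q v] assms p(1) by simp
qed

text \<open>A prefix \<open>p\<close> with \<open>3 * k - 1\<close> in-neighbours of
  \<open>v\<close> leaves at least \<open>k + 1\<close> of them in \<open>q\<close>. If
  \<open>tl q\<close> has fewer than \<open>k\<close> out-neighbours, then \<open>p\<close> has at
  least \<open>3 * k\<close>, and reversing all arcs exchanges the roles.\<close>

lemma cyclic_absorb:
  assumes "joined k E V" "0 < k" "cyclic E c" "set c \<subseteq> V" "v \<notin> set c"
    and "4 * k \<le> card {u \<in> set c. E u v}" "4 * k \<le> card {w \<in> set c. E v w}"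
  shows "\<exists>c'. cyclic E c' \<and> set c' = insert v (set c)"
proof -
  have "3 * k - 1 \<le> card {u \<in> set c. E u v}" using assms(6) by simp
  then obtain p q where c: "c = p @ q" "card {u \<in> set p. E u v} = 3 * k - 1"
    by (rule prefix_card_split)
  show ?thesis
  proof (cases "k \<le> card {w \<in> set (tl q). E v w}")
    case True
    then show ?thesis using cyclic_absorb_prefix[OF assms(1,2), of p q v] assms c by simp
  next
    case False
    have q: "k + 1 \<le> card {u \<in> set q. E u v}"
      using card_Collect_append_le[of p q "\<lambda>u. E u v"] c assms(2,6) by simp
    then have "q \<noteq> []" by auto
    then have e: "[hd q] @ tl q = q" "butlast q @ [last q] = q" by auto
    \<comment> \<open>Dropping the first or last vertex of \<open>q\<close> loses at most one
      neighbour of \<open>v\<close>.\<close>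
    have one: "card {x \<in> set [y]. P x} \<le> 1" for y :: 'a and P
      by (rule order.trans[OF card_mono[of "{y}"]]) auto
    have "card {w \<in> set q. E v w} \<le> 1 + card {w \<in> set (tl q). E v w}"
      using card_Collect_append_le[of "[hd q]" "tl q" "E v"] one[of "hd q" "E v"]
      unfolding e by linarith
    moreover have "card {u \<in> set q. E u v} \<le> card {u \<in> set (butlast q). E u v} + 1"
      using card_Collect_append_le[of "butlast q" "[last q]" "\<lambda>u. E u v"] one[of "last q" "\<lambda>u. E u v"]
      unfolding e by linarith
    moreover have "4 * k \<le> card {w \<in> set p. E v w} + card {w \<in> set q. E v w}"
      using card_Collect_append_le[of p q "E v"] assms(7) unfolding c(1) by linarith
    ultimately have "3 * k - 1 \<le> card {w \<in> set (rev p). E v w}"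
      "k \<le> card {u \<in> set (tl (rev q)). E u v}"
      using False q butlast_rev[of "rev q"] by simp_all
    \<comment> \<open>The reversed cycle starts with \<open>rev q\<close>; a rotation puts
      \<open>rev p\<close> first.\<close>
    moreover have "cyclic (\<lambda>x y. E y x) (rev p @ rev q)"
      using cyclic_rotate[of "\<lambda>x y. E y x" "rev q" "rev p"] cyclic_rev[OF assms(3)] c(1) by simp
    ultimately obtain c' where "cyclic (\<lambda>x y. E y x) c'" "set c' = insert v (set (rev p @ rev q))"
      using cyclic_absorb_prefix[OF joined_converse[OF assms(1)] assms(2), of "rev p" "rev q" v]
        assms(4,5) c(1)
      by auto
    then show ?thesis using cyclic_rev[of "\<lambda>x y. E y x" c'] c(1) by (intro exI[of _ "rev c'"]) auto
  qed
qed

section \<open>Long paths by depth-first search\<close>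

text \<open>A depth-first search state: \<open>F\<close> is finished, \<open>P\<close> is the stack, the rest is unvisited.\<close>
lemma depth_first_state:
  assumes "finite V" "t \<le> 2 * card V"
  shows "\<exists>F P. F \<subseteq> V \<and> set P \<subseteq> V - F \<and> distinct P \<and> successively E P \<and>
    (\<forall>f\<in>F. \<forall>u\<in>V - F - set P. \<not> E f u) \<and> 2 * card F + length P = t"
  using assms(2)
proof (induction t)
  case 0
  show ?case by (intro exI[of _ "{}"] exI[of _ "[]"]) auto
next
  case (Suc t)
  then obtain F P where FP: "F \<subseteq> V" "set P \<subseteq> V - F" "distinct P" "successively E P"
    "\<forall>f\<in>F. \<forall>u\<in>V - F - set P. \<not> E f u" "2 * card F + length P = t"
    by auto
  show ?case
  proof (cases "\<exists>u\<in>V - F - set P. P = [] \<or> E (last P) u")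
    case True
    then obtain u where "u \<in> V - F - set P" "P = [] \<or> E (last P) u" by blast
    then show ?thesis using FP
      by (intro exI[of _ F] exI[of _ "P @ [u]"]) (auto simp: successively_append_iff)
  next
    \<comment> \<open>The top of the stack moves to \<open>F\<close>. Like a push, this raises
      \<open>2 * card F + length P\<close> by one.\<close>
    case False
    have "P \<noteq> []"
    proof
      assume "P = []"
      then have "V = F" using False FP(1) by auto
      then show False using Suc.prems FP(6) \<open>P = []\<close> by simp
    qed
    then have P: "P = butlast P @ [last P]" by simp
    then have "distinct (butlast P @ [last P])" "successively E (butlast P @ [last P])"
      "set (butlast P @ [last P]) \<subseteq> V - F" using FP by simp_all
    then have "distinct (butlast P)" "last P \<notin> set (butlast P)" "successively E (butlast P)"
      "last P \<in> V - F" "set (butlast P) \<subseteq> V - F"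
      by (auto simp: successively_append_iff)
    moreover have "set P = insert (last P) (set (butlast P))"
      using P by (metis list.set(2) rotate1.simps(2) set_rotate1)
    moreover have "finite F" using FP(1) assms(1) finite_subset by blast
    moreover have "length P = Suc (length (butlast P))" using \<open>P \<noteq> []\<close> by (cases P) auto
    ultimately show ?thesis using FP False
      by (intro exI[of _ "insert (last P) F"] exI[of _ "butlast P"]) auto
  qed
qed

text \<open>In the search state with \<open>t = card V\<close>, finished and unvisited vertices are
  equally many. No arc leads from the former to the latter, so there are fewer than \<open>k\<close>
  of each.\<close>

lemma ex_long_path:
  assumes "joined k E V" "finite V" "0 < k"
  obtains P where "set P \<subseteq> V" "distinct P" "successively E P" "card V + 2 \<le> length P + 2 * k"
proof -
  obtain F P where FP: "F \<subseteq> V" "set P \<subseteq> V - F" "distinct P" "successively E P"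
    "\<forall>f\<in>F. \<forall>u\<in>V - F - set P. \<not> E f u" "2 * card F + length P = card V"
    using depth_first_state[OF assms(2), of "card V" E] by auto
  have "card (V - F - set P) = card V - card F - card (set P)"
    using FP assms(2) by (simp add: card_Diff_subset finite_subset)
  then have "card (V - F - set P) = card F" using FP(3,6) by (simp add: distinct_card)
  moreover have "\<not> (k \<le> card F \<and> k \<le> card (V - F - set P))"
  proof
    assume "k \<le> card F \<and> k \<le> card (V - F - set P)"
    then obtain a b where "a \<in> F" "b \<in> V - F - set P" "E a b"
      by (metis (no_types, lifting) joinedD[OF assms(1) FP(1), of "V - F - set P"] Diff_disjoint Diff_subset
          Int_Diff empty_Diff subset_trans)
    then show False using FP(5) by blast
  qed
  ultimately have "card F < k" by linarith
  then show thesis using that[of P] FP assms(3) by auto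
qed

section \<open>Hamiltonian paths\<close>

lemma card_neighbours_ge:
  assumes "finite V" "S \<subseteq> V" "d + card (V - S) \<le> card {u \<in> V. Q u}"
  shows "d \<le> card {u \<in> S. Q u}"
proof -
  have "{u \<in> V. Q u} \<subseteq> {u \<in> S. Q u} \<union> (V - S)" by auto
  then have "card {u \<in> V. Q u} \<le> card ({u \<in> S. Q u} \<union> (V - S))"
    using assms(1) finite_subset[OF assms(2,1)] by (intro card_mono) auto
  then show ?thesis using card_Un_le[of "{u \<in> S. Q u}" "V - S"] assms(3) by linarith
qed

text \<open>Adding the arc from the last to the first vertex of \<open>P\<close> makes \<open>P\<close> a cycle.  Cutting the enlarged
  cycle behind the last vertex of \<open>P\<close> removes the extra arc again if it is still in use.\<close>
lemma path_absorb:
  assumes "joined k E V" "0 < k" "P \<noteq> []" "distinct P" "successively E P" "set P \<subseteq> V" "v \<notin> set P"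
    and "4 * k \<le> card {u \<in> set P. E u v}" "4 * k \<le> card {w \<in> set P. E v w}"
  shows "\<exists>Q. distinct Q \<and> successively E Q \<and> set Q = insert v (set P)"
proof -
  define E' where "E' x y \<longleftrightarrow> E x y \<or> x = last P \<and> y = hd P" for x y
  have "cyclic E' P"
    using assms(3-5) by (auto simp: cyclic_def E'_def intro: successively_mono)
  moreover have "joined k E' V" by (rule joined_mono[OF assms(1)]) (auto simp: E'_def)
  moreover have "card {u \<in> set P. E u v} \<le> card {u \<in> set P. E' u v}"
    "card {w \<in> set P. E v w} \<le> card {w \<in> set P. E' v w}"
    by (auto intro!: card_mono simp: E'_def)
  ultimately obtain c where c: "cyclic E' c" "set c = insert v (set P)"
    using cyclic_absorb[of k E' V P v] assms by auto
  then obtain s t where "c = (s @ [last P]) @ t"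
    using split_list[of "last P" c] assms(3) by auto
  then have Q: "cyclic E' (t @ s @ [last P])" "set (t @ s @ [last P]) = insert v (set P)"
    using cyclic_rotate[of E' "s @ [last P]" t] c by auto
  have "successively E (t @ s)"
    by (rule successively_mono[of E']) (use Q(1) in \<open>auto simp: cyclic_def successively_append_iff E'_def\<close>)
  moreover have "t @ s \<noteq> [] \<Longrightarrow> E (last (t @ s)) (last P)"
  proof -
    assume ne: "t @ s \<noteq> []"
    then have "E' (last (t @ s)) (last P)"
      using Q(1) successively_append_iff[of E' "t @ s" "[last P]"] by (auto simp: cyclic_def)
    moreover have "last (t @ s) \<noteq> last P"
      using Q(1) last_in_set[OF ne] by (auto simp: cyclic_def)
    ultimately show ?thesis by (simp add: E'_def)
  qed
  ultimately have "successively E ((t @ s) @ [last P])"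
    by (subst successively_append_iff) auto
  then show ?thesis using Q by (intro exI[of _ "t @ s @ [last P]"]) (auto simp: cyclic_def)
qed

text \<open>A longest path misses at most \<open>2 * k - 2\<close> vertices. A missed vertex would
  keep at least \<open>4 * k\<close> in- and out-neighbours on the path and could be
  absorbed.\<close>

lemma ex_hamiltonian_path:
  assumes "joined k E V" "finite V" "0 < k" "V \<noteq> {}"
    and "\<And>v. v \<in> V \<Longrightarrow> 6 * k - 1 \<le> card {u \<in> V. E u v}"
    and "\<And>v. v \<in> V \<Longrightarrow> 6 * k - 1 \<le> card {w \<in> V. E v w}"
  obtains P where "set P = V" "distinct P" "successively E P"
proof -
  let ?path = "\<lambda>P. set P \<subseteq> V \<and> distinct P \<and> successively E P"
  obtain P0 where P0: "?path P0" "card V + 2 \<le> length P0 + 2 * k"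
    using ex_long_path[OF assms(1-3)] by metis
  have bound: "?path P \<Longrightarrow> length P \<le> card V" for P
    using card_mono[OF assms(2), of "set P"] by (simp add: distinct_card)
  obtain P where P: "?path P" and max: "\<And>Q. ?path Q \<Longrightarrow> length Q \<le> length P"
    using ex_has_greatest_nat[of ?path P0 length "Suc (card V)"] P0(1) bound
    by (metis le_imp_less_Suc less_imp_le_nat)
  have long: "card V + 2 \<le> length P + 2 * k" using max[OF P0(1)] P0(2) by linarith
  have "set P = V"
  proof (rule ccontr)
    assume "set P \<noteq> V"
    then obtain v where v: "v \<in> V" "v \<notin> set P" using P by blast
    have "card {u \<in> V. E u v} \<le> card V" by (rule card_mono) (use assms(2) in auto)
    then have "P \<noteq> []" using long assms(3) assms(5)[OF v(1)] by auto
    moreover have "card (V - set P) \<le> 2 * k - 2"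
      using long P by (simp add: card_Diff_subset distinct_card)
    then have "4 * k + card (V - set P) \<le> 6 * k - 1" using assms(3) by linarith
    then have "4 * k \<le> card {u \<in> set P. E u v}" "4 * k \<le> card {w \<in> set P. E v w}"
      using card_neighbours_ge[OF assms(2), of "set P"] P assms(5,6)[OF v(1)] by (meson le_trans)+
    ultimately obtain Q where "distinct Q" "successively E Q" "set Q = insert v (set P)"
      using path_absorb[OF assms(1,3), of P v] P v by blast
    then have "?path Q" "length Q = Suc (length P)"
      using P v by (auto simp: distinct_card[symmetric])
    then show False using max[of Q] by simp
  qed
  then show thesis using that P by blast
qed

section \<open>Cycles of every length\<close>

text \<open>Serves for the in- and out-neighbourhood of one vertex, which may overlap because of
  2-cycles.\<close>

lemma ex_disjoint_subsets:
  assumes "finite S" "finite T" "2 * k \<le> card S" "2 * k \<le> card T"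
  obtains A B where "A \<subseteq> S" "B \<subseteq> T" "A \<inter> B = {}" "card A = k" "card B = k"
proof -
  obtain A where A: "A \<subseteq> S" "card A = k" using obtain_subset_with_card_n[of k S] assms(3) by auto
  then have "k \<le> card (T - A)" using diff_card_le_card_Diff[of A T] assms(1,4) finite_subset by fastforce
  then obtain B where "B \<subseteq> T - A" "card B = k" by (rule obtain_subset_with_card_n)
  then show thesis using A that by blast
qed

lemma ex_short_cycle:
  assumes "joined k E V" "finite V" "0 < k" "\<And>x. \<not> E x x"
    and din: "\<And>v. v \<in> V \<Longrightarrow> 8 * k \<le> card {u \<in> V. E u v}"
    and dout: "\<And>v. v \<in> V \<Longrightarrow> 8 * k \<le> card {w \<in> V. E v w}"
    and "V \<noteq> {}" "3 \<le> l" "l + 4 * k \<le> card V + 4"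
  shows "\<exists>c. cyclic E c \<and> set c \<subseteq> V \<and> length c = l"
proof -
  obtain v where v: "v \<in> V" using assms(7) by blast
  obtain A B where AB: "A \<subseteq> {w \<in> V. E v w}" "B \<subseteq> {u \<in> V. E u v}" "A \<inter> B = {}"
    "card A = k" "card B = k"
    using ex_disjoint_subsets[of "{w \<in> V. E v w}" "{u \<in> V. E u v}" k] din[OF v] dout[OF v] assms(2)
    by auto
  have AV: "A \<subseteq> V" "B \<subseteq> V" "v \<notin> A" "v \<notin> B" "finite A" "finite B"
    using AB assms(2,4) by (auto intro: finite_subset)
  show ?thesis
  proof (cases "l = 3")
    \<comment> \<open>Length 3 would need an empty window, so an arc from \<open>A\<close> to
      \<open>B\<close> is used directly.\<close>
    case True
    obtain a b where "a \<in> A" "b \<in> B" "E a b"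
      using joinedD[OF assms(1) AV(1,2) AB(3)] AB(4,5) by auto
    then show ?thesis using AB AV True v assms(4)
      by (intro exI[of _ "[v, a, b]"]) (auto simp: cyclic_def)
  next
    case False
    define W where "W = V - insert v (A \<union> B)"
    have rm: "card (insert v (A \<union> B)) = 2 * k + 1"
      using AV AB by (simp add: card_Un_disjoint)
    have W: "finite W" "W \<subseteq> V" "card W = card V - (2 * k + 1)" "V - W = insert v (A \<union> B)"
      unfolding W_def using assms(2) AV v rm by (auto simp: card_Diff_subset)
    \<comment> \<open>Removing \<open>2 * k + 1\<close> vertices lowers the degree bound
      \<open>8 * k\<close> to \<open>6 * k - 1\<close>.\<close>
    have "6 * k - 1 + card (V - W) \<le> 8 * k" using assms(3) W(4) rm by simp
    then have deg: "6 * k - 1 \<le> card {u \<in> W. E u x}" "6 * k - 1 \<le> card {w \<in> W. E x w}"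
      if "x \<in> V" for x
      using card_neighbours_ge[OF assms(2) W(2)] din[OF that] dout[OF that] by (meson le_trans)+
    have "W \<noteq> {}" using deg(1)[OF v] assms(3) by auto
    have "joined k E W" by (rule joined_mono[OF assms(1) W(2)])
    then obtain P where P: "set P = W" "distinct P" "successively E P"
      by (rule ex_hamiltonian_path[OF _ W(1) assms(3) \<open>W \<noteq> {}\<close>]) (use deg W(2) in auto)
    define j where "j = l - 3"
    have j: "0 < j" "l = j + 3" using False assms(8) by (auto simp: j_def)
    have lenP: "length P = card W" using P distinct_card by metis
    have jP: "j + 2 * k \<le> length P + 2" using assms(9) j W(3) lenP by linarith
    \<comment> \<open>\<open>X\<close> holds the start positions of windows of \<open>j\<close>
      vertices. As \<open>P\<close> has \<open>card V - (2 * k + 1)\<close> vertices and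
      \<open>j + 4 * k \<le> card V + 1\<close>, there are at least \<open>2 * k - 1\<close> of
      them.\<close>
    define X where "X = {..length P - j}"
    have lt: "i + j - 1 < length P" "i < length P" if "i \<in> X" for i
      using that j jP assms(3) by (auto simp: X_def)
    obtain i a b where i: "i \<in> X" "a \<in> A" "b \<in> B" "E a (P ! i)" "E (P ! (i + j - 1)) b"
    proof (rule joined_pick[OF assms(1,3), of X A "(!) P" B "\<lambda>i. P ! (i + j - 1)"])
      show "2 * k - 1 \<le> card X" unfolding X_def using jP by simp
      show "inj_on ((!) P) X" "inj_on (\<lambda>i. P ! (i + j - 1)) X"
        using lt P(2) j(1) by (auto simp: inj_on_def nth_eq_iff_index_eq)
      show "(!) P ` X \<subseteq> V - A" "(\<lambda>i. P ! (i + j - 1)) ` X \<subseteq> V - B"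
        using lt P(1) nth_mem by (fastforce simp: W_def)+
    qed (use AV AB in \<open>auto simp: X_def\<close>)
    define Q where "Q = take j (drop i P)"
    have lenQ: "length Q = j" using lt[OF i(1)] j by (auto simp: Q_def)
    then have Q: "Q \<noteq> []" "hd Q = P ! i" "last Q = P ! (i + j - 1)"
      using j lt[OF i(1)] by (auto simp: Q_def hd_conv_nth last_conv_nth)
    have "P = take i P @ Q @ drop j (drop i P)" by (metis Q_def append_take_drop_id)
    then have "distinct Q" "successively E Q" "set Q \<subseteq> W"
      using P
      by (metis distinct_append, metis successively_append_iff, metis Un_subset_iff order_refl set_append)
    moreover have "a \<notin> W" "b \<notin> W" "v \<notin> W" "a \<noteq> b" "a \<noteq> v" "b \<noteq> v" "E v a" "E b v"
      using i AB AV by (auto simp: W_def)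
    ultimately have "cyclic E (v # a # Q @ [b])"
      using Q i by (auto simp: cyclic_def successively_Cons successively_append_iff)
    moreover have "set (v # a # Q @ [b]) \<subseteq> V" using v i AV \<open>set Q \<subseteq> W\<close> W(2) by auto
    ultimately show ?thesis using lenQ j by (intro exI[of _ "v # a # Q @ [b]"]) auto
  qed
qed

lemma ex_cycle_of_length:
  assumes "joined k E V" "finite V" "0 < k" "\<And>x. \<not> E x x"
    and din: "\<And>v. v \<in> V \<Longrightarrow> 8 * k \<le> card {u \<in> V. E u v}"
    and dout: "\<And>v. v \<in> V \<Longrightarrow> 8 * k \<le> card {w \<in> V. E v w}"
    and "3 \<le> l" "l \<le> card V"
  shows "\<exists>c. cyclic E c \<and> set c \<subseteq> V \<and> length c = l"
  using assms(7,8)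
proof (induction l)
  case (Suc l)
  have ne: "V \<noteq> {}" using Suc.prems by auto
  then obtain x where "x \<in> V" by blast
  have "card {u \<in> V. E u x} \<le> card V" by (rule card_mono) (use assms(2) in auto)
  then have n: "8 * k \<le> card V" using din[OF \<open>x \<in> V\<close>] by linarith
  show ?case
  proof (cases "Suc l + 4 * k \<le> card V + 4")
    case True
    then show ?thesis using ex_short_cycle[OF assms(1-4) din dout ne] Suc.prems by blast
  next
    case False
    \<comment> \<open>In fact \<open>l \<ge> 4 * k + 4\<close>, so the induction hypothesis
      applies.\<close>
    then have "3 \<le> l" using n assms(3) by linarith
    then obtain c where c: "cyclic E c" "set c \<subseteq> V" "length c = l" using Suc by auto
    have cc: "card (set c) = l" using c by (simp add: cyclic_def distinct_card)
    then have "\<not> V \<subseteq> set c" using card_mono[of "set c" V] Suc.prems(2) by auto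
    then obtain v where v: "v \<in> V" "v \<notin> set c" by blast
    have "card (V - set c) = card V - l" using c cc by (simp add: card_Diff_subset)
    \<comment> \<open>The cycle misses at most \<open>4 * k - 4\<close> vertices, so enough
      neighbours of \<open>v\<close> lie on it.\<close>
    then have "4 * k + card (V - set c) \<le> 8 * k" using False n by linarith
    then have "4 * k \<le> card {u \<in> set c. E u v}" "4 * k \<le> card {w \<in> set c. E v w}"
      using card_neighbours_ge[OF assms(2) c(2)] din[OF v(1)] dout[OF v(1)] by (meson le_trans)+
    then obtain c' where c': "cyclic E c'" "set c' = insert v (set c)"
      using cyclic_absorb[OF assms(1,3) c(1,2) v(2)] by blast
    then have "length c' = card (insert v (set c))" by (metis cyclic_def distinct_card)
    then show ?thesis using c' c cc v by (intro exI[of _ c']) auto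
  qed
qed simp

section \<open>From vertex lists and neighbour counts to arcs and degrees\<close>

lemma (in wf_digraph) ex_awalk_of_vertices:
  assumes "successively (\<lambda>x y. x \<rightarrow>\<^bsub>G\<^esub> y) (x # xs)" "x \<in> verts G"
  shows "\<exists>p. awalk x p (last (x # xs)) \<and> awalk_verts x p = x # xs"
  using assms
proof (induction xs arbitrary: x)
  case Nil
  then show ?case by (intro exI[of _ "[]"]) (auto simp: awalk_Nil_iff)
next
  case (Cons y xs)
  then obtain e where e: "e \<in> arcs G" "tail G e = x" "head G e = y"
    by (auto simp: arcs_ends_def arc_to_ends_def)
  then have "y \<in> verts G" by auto
  moreover have "successively (\<lambda>x y. x \<rightarrow>\<^bsub>G\<^esub> y) (y # xs)" using Cons.prems(1) by simp
  ultimately obtain p where "awalk y p (last (y # xs))" "awalk_verts y p = y # xs"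
    using Cons.IH by blast
  with e show ?case by (intro exI[of _ "e # p"]) (auto simp: awalk_Cons_iff)
qed

text \<open>Repeating the first vertex at the end gives the vertex list of a closed walk with as
  many arcs as \<open>c\<close> has entries; \<open>cycle\<close> asks for distinctness only of the
  tail of that list.\<close>

lemma (in wf_digraph) cycle_of_cyclic:
  assumes "cyclic (\<lambda>x y. x \<rightarrow>\<^bsub>G\<^esub> y) c" "set c \<subseteq> verts G"
  shows "\<exists>p. cycle p \<and> length p = length c"
proof -
  obtain x xs where c: "c = x # xs" using assms(1) by (cases c) (auto simp: cyclic_def)
  have "successively (\<lambda>x y. x \<rightarrow>\<^bsub>G\<^esub> y) (x # xs @ [x])"
    using assms(1) successively_append_iff[of _ "x # xs" "[x]"] by (simp add: c cyclic_def)
  then obtain p where p: "awalk x p x" "awalk_verts x p = x # xs @ [x]"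
    using ex_awalk_of_vertices[of x "xs @ [x]"] assms(2) c by auto
  then have len: "length p = length c" using length_awalk_verts[of x p] c by simp
  have "cycle p"
    unfolding cycle_def using p len assms(1) c by (intro exI[of _ x]) (auto simp: cyclic_def)
  then show ?thesis using len by blast
qed

text \<open>Without parallel arcs, an arc into \<open>v\<close> is determined by its tail.\<close>

lemma (in digraph) card_in_neighbours: "in_degree G v = card {u \<in> verts G. u \<rightarrow>\<^bsub>G\<^esub> v}"
proof -
  have "{u \<in> verts G. u \<rightarrow>\<^bsub>G\<^esub> v} = tail G ` in_arcs G v"
    by (auto simp: in_arcs_def arcs_ends_def arc_to_ends_def)
  moreover have "inj_on (tail G) (in_arcs G v)"
    by (auto simp: inj_on_def in_arcs_def arc_to_ends_def intro!: no_multi_arcs)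
  ultimately show ?thesis by (simp add: in_degree_def card_image)
qed

lemma (in digraph) card_out_neighbours: "out_degree G v = card {w \<in> verts G. v \<rightarrow>\<^bsub>G\<^esub> w}"
proof -
  have "{w \<in> verts G. v \<rightarrow>\<^bsub>G\<^esub> w} = head G ` out_arcs G v"
    by (auto simp: out_arcs_def arcs_ends_def arc_to_ends_def)
  moreover have "inj_on (head G) (out_arcs G v)"
    by (auto simp: inj_on_def out_arcs_def arc_to_ends_def intro!: no_multi_arcs)
  ultimately show ?thesis by (simp add: out_degree_def card_image)
qed

theorem theorem2:
  fixes D :: "('a, 'b) pre_digraph" and k :: nat
  assumes "k > 0"
    and "digraph D"
    and "\<And>v. v \<in> verts D \<Longrightarrow> in_degree D v \<ge> 8 * k"
    and "\<And>v. v \<in> verts D \<Longrightarrow> out_degree D v \<ge> 8 * k"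
    and "\<And>A B. \<lbrakk>A \<subseteq> verts D; B \<subseteq> verts D; A \<inter> B = {}; card A = card B; card A \<ge> k\<rbrakk>
           \<Longrightarrow> \<exists>a\<in>A. \<exists>b\<in>B. a \<rightarrow>\<^bsub>D\<^esub> b"
  shows "pancyclic D"
  unfolding pancyclic_def
proof
  interpret digraph D by fact
  fix l assume l: "l \<in> {3..card (verts D)}"
  have "joined k (\<lambda>x y. x \<rightarrow>\<^bsub>D\<^esub> y) (verts D)"
    unfolding joined_def
  proof (intro allI impI)
    fix A B assume AB: "A \<subseteq> verts D" "B \<subseteq> verts D" "A \<inter> B = {}" "k \<le> card A" "k \<le> card B"
    \<comment> \<open>Both sets are shrunk to size \<open>k\<close> because the hypothesis speaks of
      sets of equal size.\<close>
    obtain A' where A': "A' \<subseteq> A" "card A' = k" using AB(4) by (rule obtain_subset_with_card_n)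
    obtain B' where B': "B' \<subseteq> B" "card B' = k" using AB(5) by (rule obtain_subset_with_card_n)
    have "\<exists>a\<in>A'. \<exists>b\<in>B'. a \<rightarrow>\<^bsub>D\<^esub> b" using A' B' AB by (intro assms(5)) auto
    then show "\<exists>a\<in>A. \<exists>b\<in>B. a \<rightarrow>\<^bsub>D\<^esub> b" using A'(1) B'(1) by blast
  qed
  then obtain c where "cyclic (\<lambda>x y. x \<rightarrow>\<^bsub>D\<^esub> y) c" "set c \<subseteq> verts D" "length c = l"
    using ex_cycle_of_length[of k "\<lambda>x y. x \<rightarrow>\<^bsub>D\<^esub> y" "verts D" l] l assms(1,3,4)
      adj_not_same card_in_neighbours card_out_neighbours by auto
  then show "\<exists>p. cycle p \<and> length p = l" using cycle_of_cyclic by blast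
qed

end
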